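(* For every integer $k\ge 4$, every positive integer $n$ is a sum of $k$ nonzero triangular numbers, except for $n=1,2,\ldots,k-1$, $n=k+1$, and $n=k+3$.
   Context: A triangular number is a number of the form $x(x+1)/2$ with $x\in\mathbb{Z}$; nonzero means its value is nonzero. *)

theory Defs
  imports Main
begin

text \<open>The division below is exact, since \<open>x * (x + 1)\<close> is always even.\<close>

definition triangular :: "int \<Rightarrow> bool" where
  "triangular t \<longleftrightarrow> (\<exists>x::int. t = x * (x + 1) div 2)"

definition sum_of_nonzero_triangulars :: "nat \<Rightarrow> int \<Rightarrow> bool" where
  "sum_of_nonzero_triangulars k n \<longleftrightarrow>
     (\<exists>t::nat \<Rightarrow> int. (\<forall>i<k. triangular (t i) \<and> t i \<noteq> 0) \<and> n = (\<Sum>i<k. t i))"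

end

theory Submission
  imports Defs "HOL-Library.Nat_Bijection"
begin

text \<open>
  Adding ones reduces everything to four summands. Write \<open>T x = x (x + 1) / 2\<close>. The number of
  quadruples of natural numbers with \<open>T a + T b + T c + T d = n\<close> is \<open>\<sigma> (2 n + 1) \<ge> 2 n + 2\<close>
  (Legendre): both sides satisfy the same linear recurrence, the quadruples by symmetry and the
  divisor sums by an involution argument of Zagier's kind on the binary quadratic forms of
  discriminant \<open>8 n + 5\<close>.

  Quadruples with a vanishing entry number at most four times the triples representing \<open>n\<close>. There
  are about \<open>r = sqrt (2 n)\<close> choices for one entry of such a triple, and the remaining two are
  integer points on a circular arc, of which there are at most \<open>r / 4\<close> for large \<open>r\<close> because
  neighbouring points on the arc that are close together are determined by their difference.
  Hence for \<open>n \<ge> T 672\<close> some quadruple has no vanishing entry. For smaller \<open>n\<close> one subtracts a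
  triangular number so as to land between 30 and 702, where three nonzero triangular
  numbers always suffice.
\<close>

section \<open>Ordered representations\<close>

definition reps :: "('a \<Rightarrow> nat) \<Rightarrow> nat \<Rightarrow> nat \<Rightarrow> 'a list set" where
  "reps f k n = {xs. length xs = k \<and> sum_list (map f xs) = n}"

lemma reps_0: "reps f 0 n = (if n = 0 then {[]} else {})"
  by (auto simp: reps_def)

lemma reps_Suc:
  "reps f (Suc k) n = (\<lambda>(x, xs). x # xs) ` (SIGMA x:{x. f x \<le> n}. reps f k (n - f x))"
  by (force simp: reps_def length_Suc_conv)

lemma rotate_in_reps:
  assumes "xs \<in> reps f k n"
  shows "rotate i xs \<in> reps f k n"
proof -
  let ?i = "i mod length xs"
  have "sum_list (map f (rotate i xs)) = sum_list (map f (take ?i xs @ drop ?i xs))"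
    by (simp only: rotate_drop_take map_append sum_list_append add.commute)
  then show ?thesis
    using assms by (simp add: reps_def)
qed

lemma sum_reps_nth:
  assumes "i < k"
  shows "(\<Sum>xs\<in>reps f k n. g (xs ! i)) = (\<Sum>xs\<in>reps f k n. g (hd xs))"
proof (rule sum.reindex_bij_witness[where i = "rotate (k - i)" and j = "rotate i"])
  fix xs assume "xs \<in> reps f k n"
  then have len: "length xs = k" by (simp add: reps_def)
  then have "xs \<noteq> []" using assms by auto
  with len show "rotate (k - i) (rotate i xs) = xs" "rotate i (rotate (k - i) xs) = xs"
    and "g (hd (rotate i xs)) = g (xs ! i)"
    using assms by (auto simp: rotate_rotate hd_rotate_conv_nth)
qed (simp_all add: rotate_in_reps)

lemma card_reps_2: "card (reps f 2 n) = card {(a, b). f a + f b = n}"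
proof -
  have "reps f 2 n = (\<lambda>(a, b). [a, b]) ` {(a, b). f a + f b = n}"
    by (auto simp: reps_def length_Suc_conv numeral_2_eq_2)
  then show ?thesis
    by (simp add: card_image inj_on_def case_prod_beta prod_eq_iff)
qed

context
  fixes f :: "'a \<Rightarrow> nat"
  assumes finite_le: "\<And>n. finite {x. f x \<le> n}"
begin

lemma finite_reps: "finite (reps f k n)"
  by (induction k arbitrary: n) (auto simp: reps_0 reps_Suc finite_le)

lemma sum_reps_hd:
  fixes g :: "'a \<Rightarrow> 'b::comm_semiring_1"
  shows "(\<Sum>xs\<in>reps f (Suc k) n. g (hd xs)) =
    (\<Sum>x | f x \<le> n. g x * of_nat (card (reps f k (n - f x))))"
proof -
  have "(\<Sum>xs\<in>reps f (Suc k) n. g (hd xs)) =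
      (\<Sum>(x, xs)\<in>(SIGMA x:{x. f x \<le> n}. reps f k (n - f x)). g x)"
    unfolding reps_Suc by (subst sum.reindex) (auto simp: inj_on_def intro: sum.cong)
  then show ?thesis
    by (simp add: sum.Sigma[symmetric] finite_le finite_reps mult.commute)
qed

lemma card_reps_Suc: "card (reps f (Suc k) n) = (\<Sum>x | f x \<le> n. card (reps f k (n - f x)))"
  using sum_reps_hd[of "\<lambda>_. 1::nat"] by simp

text \<open>
  By symmetry, each of the \<open>k + 1\<close> entries of a representation of \<open>n\<close> contributes \<open>n / (k + 1)\<close> on
  average.
\<close>

lemma reps_recurrence:
  "(\<Sum>x | f x \<le> n. (int n - int (Suc k) * int (f x)) * int (card (reps f k (n - f x)))) = 0"
proof -
  let ?R = "reps f (Suc k) n"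
  have "int n * int (card ?R) = (\<Sum>xs\<in>?R. int n)"
    by simp
  also have "\<dots> = (\<Sum>xs\<in>?R. \<Sum>i<Suc k. int (f (xs ! i)))"
    by (rule sum.cong) (auto simp: reps_def sum_list_sum_nth atLeast0LessThan)
  also have "\<dots> = (\<Sum>i<Suc k. \<Sum>xs\<in>?R. int (f (xs ! i)))"
    by (rule sum.swap)
  also have "\<dots> = int (Suc k) * (\<Sum>xs\<in>?R. int (f (hd xs)))"
    by (simp add: sum_reps_nth[where g = "\<lambda>x. int (f x)"] del: sum.lessThan_Suc)
  finally show ?thesis
    unfolding sum_reps_hd[where g = "\<lambda>x. int (f x)"] card_reps_Suc
    by (simp add: left_diff_distrib sum_subtractf sum_distrib_left mult.assoc)
qed

lemma recurrence_unique:
  fixes u v :: "nat \<Rightarrow> 'b::{idom, ring_char_0}" and c :: 'b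
  assumes u: "\<And>n. (\<Sum>x | f x \<le> n. (of_nat n - c * of_nat (f x)) * u (n - f x)) = 0"
    and v: "\<And>n. (\<Sum>x | f x \<le> n. (of_nat n - c * of_nat (f x)) * v (n - f x)) = 0"
    and initial: "u 0 = v 0"
    and zero: "\<And>x. f x = 0 \<longleftrightarrow> x = z"
  shows "u n = v n"
proof (induction n rule: less_induct)
  case (less n)
  show ?case
  proof (cases "n = 0")
    case False
    let ?t = "\<lambda>x. (of_nat n - c * of_nat (f x)) * (u (n - f x) - v (n - f x))"
    have "sum ?t {z} = sum ?t {x. f x \<le> n}"
    proof (rule sum.mono_neutral_left)
      have "n - f x < n" if "x \<noteq> z" for x
        using zero[of x] that False by simp
      then show "\<forall>x\<in>{x. f x \<le> n} - {z}. ?t x = 0"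
        using less.IH by simp
    qed (use zero[of z] in \<open>simp_all add: finite_le\<close>)
    also have "\<dots> = 0"
      using u[of n] v[of n] by (simp add: right_diff_distrib sum_subtractf)
    finally show ?thesis
      using False zero[of z] by simp
  qed (simp add: initial)
qed

lemma card_reps_containing_le:
  "card {xs \<in> reps f (Suc k) n. z \<in> set xs} \<le> Suc k * card (reps f k (n - f z))"
proof -
  let ?insert = "\<lambda>(i, xs). take i xs @ z # drop i xs"
  have "{xs \<in> reps f (Suc k) n. z \<in> set xs} \<subseteq> ?insert ` ({..k} \<times> reps f k (n - f z))"
  proof
    fix xs assume "xs \<in> {xs \<in> reps f (Suc k) n. z \<in> set xs}"
    then obtain ys zs where "xs = ys @ z # zs" "xs \<in> reps f (Suc k) n"
      using split_list by fastforce
    then show "xs \<in> ?insert ` ({..k} \<times> reps f k (n - f z))"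
      by (intro image_eqI[of _ _ "(length ys, ys @ zs)"]) (auto simp: reps_def)
  qed
  then have "card {xs \<in> reps f (Suc k) n. z \<in> set xs} \<le> card ({..k} \<times> reps f k (n - f z))"
    by (rule surj_card_le[rotated]) (simp add: finite_reps)
  then show ?thesis
    by (simp add: card_cartesian_product)
qed

end

section \<open>Divisor sums\<close>

text \<open>The triple \<open>(a, b, c)\<close> stands for the indefinite form \<open>a u\<^sup>2 + b u v - c v\<^sup>2\<close>.\<close>

definition forms :: "int \<Rightarrow> (int \<times> int \<times> int) set" where
  "forms N = {(a, b, c). a > 0 \<and> c > 0 \<and> b\<^sup>2 + 4 * a * c = N}"

lemma finite_square_less: "finite {b. b\<^sup>2 < (N :: int)}"
proof (rule finite_subset)
  show "{b. b\<^sup>2 < N} \<subseteq> {-N..N}"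
  proof
    fix b assume "b \<in> {b. b\<^sup>2 < N}"
    moreover have "\<bar>b\<bar> \<le> b\<^sup>2"
      using self_le_power[of "\<bar>b\<bar>" 2] by (cases "b = 0") auto
    ultimately show "b \<in> {-N..N}" by auto
  qed
qed simp

lemma finite_forms: "finite (forms N)"
proof (rule finite_subset)
  show "forms N \<subseteq> {1..N} \<times> {b. b\<^sup>2 < N} \<times> {1..N}"
  proof
    fix t assume "t \<in> forms N"
    then obtain a b c where t: "t = (a, b, c)" and ac: "a > 0" "c > 0" and N: "N = b\<^sup>2 + 4 * (a * c)"
      by (auto simp: forms_def)
    have "a \<le> a * c" "c \<le> a * c"
      using ac by (simp_all add: mult_le_cancel_left1 mult_le_cancel_right1)
    moreover have "0 \<le> b\<^sup>2" by simp
    ultimately show "t \<in> {1..N} \<times> {b. b\<^sup>2 < N} \<times> {1..N}"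
      using ac unfolding t N mem_Times_iff atLeastAtMost_iff mem_Collect_eq fst_conv snd_conv by linarith
  qed
qed (simp add: finite_square_less)

lemma sum_antisymmetric_eq_0:
  fixes F :: "'a \<Rightarrow> 'b::linordered_ab_group_add"
  assumes "\<And>x. x \<in> A \<Longrightarrow> h x \<in> A" "\<And>x. x \<in> A \<Longrightarrow> h (h x) = x" "\<And>x. x \<in> A \<Longrightarrow> F (h x) = - F x"
  shows "sum F A = 0"
proof -
  have "sum F A = (\<Sum>x\<in>A. - F x)"
    by (rule sum.reindex_bij_witness[where i = h and j = h]) (simp_all add: assms)
  then show ?thesis
    by (simp add: sum_negf)
qed

text \<open>
  The involution \<open>(a, b, c) \<mapsto> (c, -b, a)\<close> negates the value \<open>a + b - c\<close> of the form at \<open>(1, 1)\<close>, which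
  vanishes only if the discriminant is a square.
\<close>

lemma sum_forms_fold:
  fixes F :: "int \<times> int \<times> int \<Rightarrow> int"
  assumes nonsquare: "\<And>x. x\<^sup>2 \<noteq> N"
  shows "sum F (forms N) =
    (\<Sum>(a, b, c)\<in>{(a, b, c) \<in> forms N. a + b < c}. F (a, b, c) + F (c, -b, a))"
proof -
  let ?P = "{(a, b, c) \<in> forms N. a + b < c}" and ?Q = "{(a, b, c) \<in> forms N. c < a + b}"
  have "a + b \<noteq> c" if "(a, b, c) \<in> forms N" for a b c
  proof
    assume "a + b = c"
    then have "(b + 2 * a)\<^sup>2 = N"
      using that by (auto simp: forms_def power2_eq_square algebra_simps)
    then show False using nonsquare by blast
  qed
  then have "forms N = ?P \<union> ?Q"
    by (auto simp: neq_iff)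
  then have "sum F (forms N) = sum F (?P \<union> ?Q)"
    by simp
  also have "\<dots> = sum F ?P + sum F ?Q"
    by (rule sum.union_disjoint) (auto intro: finite_subset[OF _ finite_forms])
  also have "sum F ?Q = (\<Sum>(a, b, c)\<in>?P. F (c, -b, a))"
    by (rule sum.reindex_bij_witness[where
          i = "\<lambda>(a, b, c). (c, -b, a)" and j = "\<lambda>(a, b, c). (c, -b, a)"])
       (auto simp: forms_def algebra_simps)
  finally show ?thesis
    by (simp add: sum.distrib case_prod_unfold)
qed

lemma sum_forms_eq_0:
  assumes nonsquare: "\<And>x. x\<^sup>2 \<noteq> N"
  shows "(\<Sum>(a, b, c)\<in>forms N. a * (N - 5 * b\<^sup>2)) = 0"
proof -
  have odd_part: "(\<Sum>(a, b, c)\<in>forms N. 4 * a\<^sup>2 * b) = 0"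
    by (rule sum_antisymmetric_eq_0[where h = "\<lambda>(a, b, c). (a, -b, c)"]) (auto simp: forms_def)
  \<comment> \<open>Subtracting the odd part makes the folded summand antisymmetric under the substitution
    \<open>u \<mapsto> v - u\<close>, which interchanges the conditions \<open>c > 0\<close> and \<open>a + b < c\<close>.\<close>
  have "(\<Sum>(a, b, c)\<in>forms N. a * (N - 5 * b\<^sup>2)) =
      (\<Sum>(a, b, c)\<in>forms N. a * (N - 5 * b\<^sup>2) - 4 * a\<^sup>2 * b)"
    using odd_part by (simp add: case_prod_unfold sum_subtractf)
  also have "\<dots> = (\<Sum>(a, b, c)\<in>{(a, b, c) \<in> forms N. a + b < c}. 4 * (a + b) * (a + c) * (c - b))"
    unfolding sum_forms_fold[OF nonsquare]
    by (rule sum.cong) (auto simp: forms_def power2_eq_square algebra_simps)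
  also have "\<dots> = 0"
    by (rule sum_antisymmetric_eq_0[where h = "\<lambda>(a, b, c). (a, -b - 2 * a, c - b - a)"])
       (auto simp: forms_def power2_eq_square algebra_simps)
  finally show ?thesis .
qed

definition divisor_sum :: "nat \<Rightarrow> nat" where
  "divisor_sum m = \<Sum>{d. d dvd m}"

lemma Suc_le_divisor_sum:
  assumes "m > 1"
  shows "Suc m \<le> divisor_sum m"
proof -
  have "\<Sum>{1, m} \<le> divisor_sum m"
    unfolding divisor_sum_def using assms by (intro sum_mono2) auto
  then show ?thesis using assms by simp
qed

lemma sum_forms_by_middle_coefficient:
  "(\<Sum>(a, b, c)\<in>forms N. a * g b) =
    (\<Sum>b | b\<^sup>2 < N \<and> 4 dvd N - b\<^sup>2. int (divisor_sum (nat ((N - b\<^sup>2) div 4))) * g b)"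
proof -
  let ?B = "{b. b\<^sup>2 < N \<and> 4 dvd N - b\<^sup>2}" and ?m = "\<lambda>b. nat ((N - b\<^sup>2) div 4)"
  have m: "N - b\<^sup>2 = 4 * int (?m b)" "0 < ?m b" if "b \<in> ?B" for b
    using that by auto
  have "(\<Sum>(a, b, c)\<in>forms N. a * g b) = (\<Sum>(b, d)\<in>(SIGMA b:?B. {d. d dvd ?m b}). int d * g b)"
  proof (rule sum.reindex_bij_witness[where
        i = "\<lambda>(b, d). (int d, b, int (?m b div d))" and j = "\<lambda>(a, b, c). (b, nat a)"])
    fix t assume "t \<in> forms N"
    then obtain a b c where t: "t = (a, b, c)" and ac: "a > 0" "c > 0" and N: "N = b\<^sup>2 + 4 * (a * c)"
      by (auto simp: forms_def)
    have "?m b = nat a * nat c"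
      using ac by (simp add: N nat_mult_distrib)
    then show "(case (case t of (a, b, c) \<Rightarrow> (b, nat a)) of (b, d) \<Rightarrow> (int d, b, int (?m b div d))) = t"
      and "(case t of (a, b, c) \<Rightarrow> (b, nat a)) \<in> (SIGMA b:?B. {d. d dvd ?m b})"
      and "(case (case t of (a, b, c) \<Rightarrow> (b, nat a)) of (b, d) \<Rightarrow> int d * g b) =
        (case t of (a, b, c) \<Rightarrow> a * g b)"
      using ac by (auto simp: t N)
  next
    fix s assume "s \<in> (SIGMA b:?B. {d. d dvd ?m b})"
    then obtain b d where s: "s = (b, d)" and b: "b \<in> ?B" and d: "d dvd ?m b"
      by auto
    obtain e where e: "?m b = d * e" using d by (elim dvdE)
    have "N - b\<^sup>2 = 4 * (int d * int e)" "d > 0" "e > 0"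
      using m[OF b] unfolding e by simp_all
    then show "(case s of (b, d) \<Rightarrow> (int d, b, int (?m b div d))) \<in> forms N"
      unfolding s case_prod_conv e by (simp add: forms_def)
    show "(case (case s of (b, d) \<Rightarrow> (int d, b, int (?m b div d))) of (a, b, c) \<Rightarrow> (b, nat a)) = s"
      by (simp add: s)
  qed
  also have "\<dots> = (\<Sum>b\<in>?B. \<Sum>d | d dvd ?m b. int d * g b)"
  proof (rule sum.Sigma[symmetric])
    show "finite ?B"
      by (rule finite_subset[OF _ finite_square_less]) auto
    show "\<forall>b\<in>?B. finite {d. d dvd ?m b}"
      using m(2) by (auto intro: finite_divisors_nat)
  qed
  finally show ?thesis
    by (simp add: divisor_sum_def sum_distrib_right)
qed

section \<open>Four triangular numbers\<close>

lemma double_triangle: "2 * triangle n = n * Suc n"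
  by (simp add: triangle_def)

lemma triangle_add: "triangle (m + n) = triangle m + triangle n + m * n"
  by (induction n) simp_all

lemma strict_mono_triangle: "strict_mono triangle"
  by (simp add: strict_mono_Suc_iff)

lemmas triangle_less_iff = strict_mono_less[OF strict_mono_triangle]
lemmas triangle_le_iff = strict_mono_less_eq[OF strict_mono_triangle]
lemmas triangle_eq_iff = strict_mono_eq[OF strict_mono_triangle]

lemma le_triangle: "n \<le> triangle n"
  using strict_mono_triangle by (rule strict_mono_imp_increasing)

lemma triangle_eq_0_iff: "triangle n = 0 \<longleftrightarrow> n = 0"
  using triangle_eq_iff[of n 0] by simp

lemma finite_triangle_le: "finite {x. triangle x \<le> n}"
  by (rule finite_subset[of _ "{..n}"]) (auto intro: order_trans[OF le_triangle])

lemma triangle_bracket: obtains r where "triangle r \<le> n" "n < triangle (Suc r)"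
proof -
  obtain i j where "n = prod_encode (i, j)"
    by (metis surj_pair prod_decode_inverse)
  then show ?thesis
    using that[of "i + j"] by (simp add: prod_encode_def)
qed

lemma square_mod_8_neq_5: "x\<^sup>2 mod 8 \<noteq> (5 :: int)"
proof -
  have "x mod 8 \<in> {0..7}" by simp
  also have "{0..7} = {0, 1, 2, 3, 4, 5, 6, 7 :: int}" by auto
  finally have "(x mod 8)\<^sup>2 mod 8 \<noteq> 5" by auto
  then show ?thesis
    by (simp add: power_mod)
qed

lemma odd_square_eq_triangle: "(2 * int x + 1)\<^sup>2 = 8 * int (triangle x) + 1"
  using arg_cong[OF double_triangle[of x], of int] by (simp add: power2_eq_square algebra_simps)

lemma sum_even_function:
  fixes f :: "int \<Rightarrow> 'a::comm_semiring_1"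
  assumes "finite A" "0 \<notin> A" "\<And>b. b \<in> A \<Longrightarrow> - b \<in> A" "\<And>b. f (- b) = f b"
  shows "sum f A = 2 * sum f {b \<in> A. b > 0}"
proof -
  have "b > 0 \<or> b < 0" if "b \<in> A" for b
    using assms(2) that by (cases "b = 0") auto
  then have "A = {b \<in> A. b > 0} \<union> {b \<in> A. b < 0}"
    by auto
  then have "sum f A = sum f ({b \<in> A. b > 0} \<union> {b \<in> A. b < 0})"
    by simp
  also have "\<dots> = sum f {b \<in> A. b > 0} + sum f {b \<in> A. b < 0}"
    using assms(1) by (intro sum.union_disjoint) auto
  also have "sum f {b \<in> A. b < 0} = sum f {b \<in> A. b > 0}"
    by (rule sum.reindex_bij_witness[where i = uminus and j = uminus]) (auto simp: assms(3,4))
  finally show ?thesis by (simp only: mult_2)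
qed

lemma sum_odd_squares:
  fixes g :: "int \<Rightarrow> 'a::comm_semiring_1"
  shows "(\<Sum>b | odd b \<and> b\<^sup>2 < N. g (b\<^sup>2)) = 2 * (\<Sum>x | (2 * int x + 1)\<^sup>2 < N. g ((2 * int x + 1)\<^sup>2))"
proof -
  let ?B = "{b. odd b \<and> b\<^sup>2 < N}"
  have "finite ?B"
    by (rule finite_subset[OF _ finite_square_less[of N]]) auto
  then have "(\<Sum>b\<in>?B. g (b\<^sup>2)) = 2 * (\<Sum>b | b \<in> ?B \<and> b > 0. g (b\<^sup>2))"
    by (rule sum_even_function) simp_all
  also have "(\<Sum>b | b \<in> ?B \<and> b > 0. g (b\<^sup>2)) = (\<Sum>x | (2 * int x + 1)\<^sup>2 < N. g ((2 * int x + 1)\<^sup>2))"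
    by (rule sum.reindex_bij_witness[where i = "\<lambda>x. 2 * int x + 1" and j = "\<lambda>b. nat (b div 2)"])
       (auto elim!: oddE)
  finally show ?thesis .
qed

lemma four_dvd_diff_square_iff: "4 dvd 8 * n + 5 - b\<^sup>2 \<longleftrightarrow> odd b" for n b :: int
proof
  assume "4 dvd 8 * n + 5 - b\<^sup>2"
  then have "even (8 * n + 5 - b\<^sup>2)"
    by (intro dvd_trans[of 2 4 "8 * n + 5 - b\<^sup>2"]) simp_all
  then show "odd b" by simp
next
  assume "odd b"
  then obtain k where "b = 2 * k + 1" by (elim oddE)
  then have "8 * n + 5 - b\<^sup>2 = 4 * (2 * n + 1 - k\<^sup>2 - k)"
    by (simp add: power2_eq_square algebra_simps)
  then show "4 dvd 8 * n + 5 - b\<^sup>2" by (simp only: dvd_triv_left)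
qed

lemma divisor_sum_recurrence:
  "(\<Sum>x | triangle x \<le> n. (int n - 5 * int (triangle x)) *
      int (divisor_sum (2 * (n - triangle x) + 1))) = 0"
proof -
  define N where "N = 8 * int n + 5"
  let ?g = "\<lambda>y. int (divisor_sum (nat ((N - y) div 4))) * (N - 5 * y)"
  let ?t = "\<lambda>x. (int n - 5 * int (triangle x)) * int (divisor_sum (2 * (n - triangle x) + 1))"
  have "N mod 8 = 5"
    unfolding N_def by presburger
  then have "0 = (\<Sum>(a, b, c)\<in>forms N. a * (N - 5 * b\<^sup>2))"
    using square_mod_8_neq_5 by (intro sum_forms_eq_0[symmetric]) blast
  also have "\<dots> = (\<Sum>b | b\<^sup>2 < N \<and> 4 dvd N - b\<^sup>2. ?g (b\<^sup>2))"
    by (rule sum_forms_by_middle_coefficient)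
  also have "{b. b\<^sup>2 < N \<and> 4 dvd N - b\<^sup>2} = {b. odd b \<and> b\<^sup>2 < N}"
    by (auto simp: N_def four_dvd_diff_square_iff)
  also have "(\<Sum>b | odd b \<and> b\<^sup>2 < N. ?g (b\<^sup>2)) =
      2 * (\<Sum>x | (2 * int x + 1)\<^sup>2 < N. ?g ((2 * int x + 1)\<^sup>2))"
    by (rule sum_odd_squares)
  also have "(\<Sum>x | (2 * int x + 1)\<^sup>2 < N. ?g ((2 * int x + 1)\<^sup>2)) = (\<Sum>x | triangle x \<le> n. 8 * ?t x)"
  proof (rule sum.cong)
    show "{x. (2 * int x + 1)\<^sup>2 < N} = {x. triangle x \<le> n}"
      unfolding odd_square_eq_triangle N_def by auto
    fix x assume "x \<in> {x. triangle x \<le> n}"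
    then have "N - (8 * int (triangle x) + 1) = 4 * int (2 * (n - triangle x) + 1)"
      by (simp add: N_def)
    then have "nat ((N - (8 * int (triangle x) + 1)) div 4) = 2 * (n - triangle x) + 1"
      by simp
    then show "?g ((2 * int x + 1)\<^sup>2) = 8 * ?t x"
      unfolding odd_square_eq_triangle by (simp add: N_def)
  qed
  finally show ?thesis
    by (simp add: sum_distrib_left[symmetric])
qed

lemma card_four_triangles: "card (reps triangle 4 n) = divisor_sum (2 * n + 1)"
proof -
  have "int (card (reps triangle 4 n)) = int (divisor_sum (2 * n + 1))"
  proof (rule recurrence_unique[OF finite_triangle_le, where c = 5 and z = 0
        and u = "\<lambda>n. int (card (reps triangle 4 n))" and v = "\<lambda>n. int (divisor_sum (2 * n + 1))"])
    show "(\<Sum>x | triangle x \<le> m. (int m - 5 * int (triangle x)) *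
        int (card (reps triangle 4 (m - triangle x)))) = 0" for m
      using reps_recurrence[OF finite_triangle_le, where k = 4 and n = m] by simp
    show "int (card (reps triangle 4 0)) = int (divisor_sum (2 * 0 + 1))"
      by (simp add: numeral_eq_Suc card_reps_Suc[OF finite_triangle_le] reps_0 triangle_eq_0_iff
          divisor_sum_def)
    show "(\<Sum>x | triangle x \<le> m. (int m - 5 * int (triangle x)) *
        int (divisor_sum (2 * (m - triangle x) + 1))) = 0" for m
      by (rule divisor_sum_recurrence)
  qed (simp add: triangle_eq_0_iff)
  then show ?thesis by simp
qed

section \<open>Two and three triangular numbers\<close>

definition triangle_pairs :: "nat \<Rightarrow> (nat \<times> nat) set" where
  "triangle_pairs m = {(a, b). triangle a + triangle b = m}"

lemma triangle_pairs_antimono: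
  assumes "(a, b) \<in> triangle_pairs m" "(c, d) \<in> triangle_pairs m"
  shows "a < c \<longleftrightarrow> d < b"
  using assms triangle_less_iff[of a c] triangle_less_iff[of d b] by (auto simp: triangle_pairs_def)

lemma triangle_pairs_le:
  assumes "(a, b) \<in> triangle_pairs m" "m < triangle (Suc r)"
  shows "a \<le> r" "b \<le> r"
  using assms triangle_less_iff[of a "Suc r"] triangle_less_iff[of b "Suc r"]
  by (auto simp: triangle_pairs_def simp del: triangle_Suc)

lemma triangle_pairs_difference_less_iff:
  assumes "(a, b) \<in> triangle_pairs m" "(c, d) \<in> triangle_pairs m" "m < triangle (Suc r)"
  shows "a + r - b < c + r - d \<longleftrightarrow> a < c"
proof -
  have "a < c \<longleftrightarrow> d < b" "c < a \<longleftrightarrow> b < d"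
    using triangle_pairs_antimono assms(1,2) by blast+
  moreover have "b \<le> r" "d \<le> r"
    using triangle_pairs_le(2) assms by blast+
  ultimately show ?thesis by linarith
qed

lemma inj_on_triangle_pairs_difference:
  assumes "m < triangle (Suc r)"
  shows "inj_on (\<lambda>(a, b). a + r - b) (triangle_pairs m)"
proof (rule inj_onI, clarify)
  fix a b c d
  assume ab: "(a, b) \<in> triangle_pairs m" and cd: "(c, d) \<in> triangle_pairs m"
    and "a + r - b = c + r - d"
  then have "a = c"
    using triangle_pairs_difference_less_iff[OF ab cd assms]
      triangle_pairs_difference_less_iff[OF cd ab assms] by simp
  then show "a = c \<and> b = d"
    using triangle_pairs_antimono[OF ab cd] triangle_pairs_antimono[OF cd ab] by simp
qed

lemma finite_triangle_pairs: "finite (triangle_pairs m)"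
proof (rule finite_subset)
  show "triangle_pairs m \<subseteq> {..m} \<times> {..m}"
    using le_triangle by (fastforce simp: triangle_pairs_def intro: order_trans)
qed simp

definition chord_starts :: "nat \<Rightarrow> nat \<Rightarrow> nat \<Rightarrow> (nat \<times> nat) set" where
  "chord_starts m p q =
    {(a, b + q) | a b. (a, b + q) \<in> triangle_pairs m \<and> (a + p, b) \<in> triangle_pairs m}"

text \<open>
  Subtracting the two equations gives \<open>a p + T p = b q + T q\<close>, so that \<open>b\<close> increases with \<open>a\<close>, whereas
  it decreases with \<open>a\<close> along the curve \<open>T a + T (b + q) = m\<close>.
\<close>

lemma card_chord_starts_le_1:
  assumes "p > 0" "q > 0"
  shows "card (chord_starts m p q) \<le> 1"
proof -
  have no_less: "\<not> a < c"
    if "(a, b + q) \<in> triangle_pairs m" "(a + p, b) \<in> triangle_pairs m"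
      and "(c, d + q) \<in> triangle_pairs m" "(c + p, d) \<in> triangle_pairs m" for a b c d
  proof
    assume "a < c"
    have "a * p + triangle p = b * q + triangle q" "c * p + triangle p = d * q + triangle q"
      using that by (simp_all add: triangle_pairs_def triangle_add)
    moreover have "a * p < c * p"
      using \<open>a < c\<close> assms by simp
    moreover have "d * q < b * q"
      using \<open>a < c\<close> triangle_pairs_antimono[OF that(1,3)] assms by simp
    ultimately show False by linarith
  qed
  have "z = w" if zw: "z \<in> chord_starts m p q" "w \<in> chord_starts m p q" for z w
  proof -
    obtain a b where z: "z = (a, b + q)"
      "(a, b + q) \<in> triangle_pairs m" "(a + p, b) \<in> triangle_pairs m"
      using zw(1) by (auto simp: chord_starts_def)
    obtain c d where w: "w = (c, d + q)"
      "(c, d + q) \<in> triangle_pairs m" "(c + p, d) \<in> triangle_pairs m"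
      using zw(2) by (auto simp: chord_starts_def)
    have "a = c"
      using no_less[OF z(2,3) w(2,3)] no_less[OF w(2,3) z(2,3)] by simp
    then show ?thesis
      using z w by (auto simp: triangle_pairs_def triangle_eq_iff)
  qed
  moreover have "finite (chord_starts m p q)"
    by (rule finite_subset[OF _ finite_triangle_pairs[of m]]) (auto simp: chord_starts_def)
  ultimately show ?thesis
    by (simp add: card_le_Suc0_iff_eq)
qed

text \<open>
  Each block of \<open>d\<close> consecutive values of \<open>u\<close> contains at most one element without a close
  successor.
\<close>

lemma card_le_blocks_plus_close:
  fixes u :: "'a \<Rightarrow> nat"
  assumes "finite A" "inj_on u A" "u ` A \<subseteq> {..M}" "d > 0"
  shows "card A \<le> Suc (M div d) + card {x \<in> A. \<exists>y\<in>A. u x < u y \<and> u y < u x + d}"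
proof -
  define C where "C = {x \<in> A. \<exists>y\<in>A. u x < u y \<and> u y < u x + d}"
  have less_add: "i < j + d" if "i div d = j div d" for i j
    using dividend_less_div_times[OF assms(4), of i] div_times_less_eq_dividend[of j d]
    unfolding that by linarith
  have "inj_on (\<lambda>x. u x div d) (A - C)"
  proof (rule inj_onI)
    fix x y assume xy: "x \<in> A - C" "y \<in> A - C" "u x div d = u y div d"
    then have "\<not> u x < u y" "\<not> u y < u x"
      using less_add[of "u y" "u x"] less_add[of "u x" "u y"] by (auto simp: C_def)
    then show "x = y"
      using xy assms(2) by (auto dest: inj_onD)
  qed
  moreover have "(\<lambda>x. u x div d) ` (A - C) \<subseteq> {..M div d}"
    using assms(3) by (auto intro!: div_le_mono)
  ultimately have "card (A - C) \<le> Suc (M div d)"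
    using card_inj_on_le[of "\<lambda>x. u x div d" "A - C" "{..M div d}"] by simp
  moreover have "card A = card (A - C) + card C"
    using card_Int_Diff[OF assms(1), of C] by (simp add: C_def Int_absorb1)
  ultimately show ?thesis
    unfolding C_def[symmetric] by simp
qed

lemma card_sum_less_le_triangle: "card {(i, j). i + j < k} \<le> triangle k"
proof -
  have "prod_encode (i, j) < triangle k" if "i + j < k" for i j
  proof -
    have "prod_encode (i, j) < triangle (Suc (i + j))"
      by (simp add: prod_encode_def)
    also have "\<dots> \<le> triangle k"
      using that by (simp only: triangle_le_iff Suc_le_eq)
    finally show ?thesis .
  qed
  then have "prod_encode ` {(i, j). i + j < k} \<subseteq> {..<triangle k}"
    by auto
  then show ?thesis
    using card_inj_on_le[OF inj_prod_encode, of "{(i, j). i + j < k}" "{..<triangle k}"] by simp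
qed

lemma card_short_chord_starts_le:
  "card (\<Union>(i, j)\<in>{(i, j). i + j < k}. chord_starts m (Suc i) (Suc j)) \<le> triangle k"
proof -
  let ?D = "{(i, j). i + j < k}"
  have "finite ?D"
    by (rule finite_subset[of _ "{..k} \<times> {..k}"]) auto
  then have "card (\<Union>(i, j)\<in>?D. chord_starts m (Suc i) (Suc j)) \<le>
      (\<Sum>(i, j)\<in>?D. card (chord_starts m (Suc i) (Suc j)))"
    using card_UN_le[of ?D "\<lambda>(i, j). chord_starts m (Suc i) (Suc j)"]
    by (simp add: case_prod_unfold)
  also have "\<dots> \<le> card ?D * 1"
    using sum_bounded_above[of ?D "\<lambda>(i, j). card (chord_starts m (Suc i) (Suc j))" 1]
    by (auto simp: card_chord_starts_le_1[unfolded One_nat_def])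
  also have "\<dots> \<le> triangle k"
    by (simp add: card_sum_less_le_triangle)
  finally show ?thesis .
qed

lemma card_triangle_pairs_le:
  assumes "m < triangle (Suc r)"
  shows "card (triangle_pairs m) \<le> Suc (2 * r div (k + 2)) + triangle k"
proof -
  let ?R = "triangle_pairs m" and ?u = "\<lambda>(a, b). a + r - b"
  let ?close = "{z \<in> ?R. \<exists>w\<in>?R. ?u z < ?u w \<and> ?u w < ?u z + (k + 2)}"
  let ?starts = "\<Union>(i, j)\<in>{(i, j). i + j < k}. chord_starts m (Suc i) (Suc j)"
  have "inj_on ?u ?R"
    using assms by (rule inj_on_triangle_pairs_difference)
  moreover have "?u ` ?R \<subseteq> {..2 * r}"
    using triangle_pairs_le(1)[OF _ assms] by fastforce
  ultimately have "card ?R \<le> Suc (2 * r div (k + 2)) + card ?close"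
    by (intro card_le_blocks_plus_close finite_triangle_pairs) simp_all
  moreover have "?close \<subseteq> ?starts"
  proof
    fix z assume "z \<in> ?close"
    moreover obtain a b where z: "z = (a, b)" by fastforce
    ultimately obtain c d where ab: "(a, b) \<in> ?R" and cd: "(c, d) \<in> ?R"
      and less: "a + r - b < c + r - d" "c + r - d < a + r - b + (k + 2)"
      by auto
    then have "a < c" "d < b"
      using triangle_pairs_difference_less_iff[OF ab cd assms]
        triangle_pairs_antimono[OF ab cd] by simp_all
    then obtain i j where ij: "c = a + Suc i" "b = d + Suc j"
      by (metis less_imp_Suc_add add_Suc_right)
    then have "i + j < k"
      using less triangle_pairs_le(2)[OF ab assms] by simp
    moreover have "z \<in> chord_starts m (Suc i) (Suc j)"
      using ab cd unfolding z ij chord_starts_def by blast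
    ultimately show "z \<in> ?starts"
      by blast
  qed
  then have "card ?close \<le> card ?starts"
    by (rule card_mono[rotated])
      (rule finite_subset[OF _ finite_triangle_pairs[of m]], auto simp: chord_starts_def)
  ultimately show ?thesis
    using card_short_chord_starts_le[where m = m and k = k] by linarith
qed

lemma card_three_triangles_le:
  assumes "n < triangle (Suc r)" "672 \<le> r"
  shows "4 * card (reps triangle 3 n) \<le> r * (r + 1)"
proof -
  \<comment> \<open>The choice \<open>k = 10\<close> minimizes the bound on \<open>r\<close> from which \<open>4 (1 + 2 r / (k + 2) + T k) \<le> r\<close>.\<close>
  have pairs: "4 * card (reps triangle 2 m) \<le> r" if "m \<le> n" for m
  proof -
    have "card (triangle_pairs m) \<le> Suc (2 * r div (10 + 2)) + triangle 10"
      using card_triangle_pairs_le[where k = 10] that assms by simp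
    then show ?thesis
      using assms(2) by (simp add: card_reps_2 triangle_pairs_def triangle_def)
  qed
  have "x < Suc r" if "triangle x \<le> n" for x
    using le_less_trans[OF that assms(1)] by (simp only: triangle_less_iff)
  then have "{x. triangle x \<le> n} \<subseteq> {..r}"
    by (auto simp: less_Suc_eq_le)
  then have "card {x. triangle x \<le> n} \<le> Suc r"
    using card_mono[of "{..r}"] by simp
  have "4 * card (reps triangle 3 n) =
      (\<Sum>x | triangle x \<le> n. 4 * card (reps triangle 2 (n - triangle x)))"
    using card_reps_Suc[OF finite_triangle_le, of 2 n]
    by (simp add: sum_distrib_left numeral_3_eq_3 numeral_2_eq_2)
  also have "\<dots> \<le> card {x. triangle x \<le> n} * r"
    using sum_bounded_above[of _ "\<lambda>x. 4 * card (reps triangle 2 (n - triangle x))" r] pairs by simp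
  also have "\<dots> \<le> Suc r * r"
    using \<open>card {x. triangle x \<le> n} \<le> Suc r\<close> by (rule mult_le_mono1)
  finally show ?thesis by (simp add: mult.commute)
qed

section \<open>Positive triangular numbers\<close>

definition positive_triangular_sum :: "nat \<Rightarrow> nat \<Rightarrow> bool" where
  "positive_triangular_sum k n \<longleftrightarrow> (\<exists>xs\<in>reps triangle k n. 0 \<notin> set xs)"

lemma positive_triangular_sum_0: "positive_triangular_sum 0 0"
  by (simp add: positive_triangular_sum_def reps_0)

lemma positive_triangular_sum_Suc:
  assumes "positive_triangular_sum k n" "x > 0"
  shows "positive_triangular_sum (Suc k) (triangle x + n)"
proof -
  obtain xs where "xs \<in> reps triangle k n" "0 \<notin> set xs"
    using assms(1) by (auto simp: positive_triangular_sum_def)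
  then show ?thesis
    using assms(2) unfolding positive_triangular_sum_def
    by (intro bexI[of _ "x # xs"]) (auto simp: reps_def)
qed

lemma positive_triangular_sum_add_ones:
  "positive_triangular_sum k n \<Longrightarrow> positive_triangular_sum (j + k) (j + n)"
proof (induction j)
  case (Suc j)
  then show ?case
    using positive_triangular_sum_Suc[of "j + k" "j + n" 1] by (simp add: triangle_def)
qed simp

lemma positive_triangular_sum_excludes:
  assumes "positive_triangular_sum k n"
  obtains j where "n = k + j" "j \<noteq> 1" "j \<noteq> 3"
proof -
  have "\<exists>j. sum_list (map triangle xs) = length xs + j \<and> j \<noteq> 1 \<and> j \<noteq> 3" if "0 \<notin> set xs" for xs
    using that
  proof (induction xs)
    case (Cons x xs)
    then obtain j where j: "sum_list (map triangle xs) = length xs + j" "j \<noteq> 1" "j \<noteq> 3" by auto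
    have "x \<noteq> 0" using Cons.prems by auto
    then consider "x = 1" | "x = 2" | "3 \<le> x" by linarith
    then have "triangle x = 1 \<or> triangle x = 3 \<or> 6 \<le> triangle x"
      using triangle_le_iff[of 3 x] by cases (simp_all add: triangle_def)
    then show ?case
      using j by (intro exI[of _ "triangle x - 1 + j"]) auto
  qed simp
  then show ?thesis
    using assms that by (auto simp: positive_triangular_sum_def reps_def)
qed

lemma four_positive_triangles_large:
  assumes "triangle 672 \<le> n"
  shows "positive_triangular_sum 4 n"
proof (rule ccontr)
  assume "\<not> positive_triangular_sum 4 n"
  then have all_zero: "reps triangle 4 n = {xs \<in> reps triangle 4 n. 0 \<in> set xs}"
    by (auto simp: positive_triangular_sum_def)
  obtain r where r: "triangle r \<le> n" "n < triangle (Suc r)" by (rule triangle_bracket)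
  have "672 \<le> r"
    using order_le_less_trans[OF assms r(2)] triangle_less_iff[of 672 "Suc r"]
    by (simp del: triangle_Suc)
  have "2 * n + 2 \<le> divisor_sum (2 * n + 1)"
    using Suc_le_divisor_sum[of "2 * n + 1"] assms le_triangle[of 672] by simp
  also have "\<dots> = card {xs \<in> reps triangle 4 n. 0 \<in> set xs}"
    by (simp only: all_zero[symmetric] card_four_triangles)
  also have "\<dots> \<le> 4 * card (reps triangle 3 n)"
    using card_reps_containing_le[OF finite_triangle_le, of 3 n 0] by simp
  also have "\<dots> \<le> r * (r + 1)"
    using r(2) \<open>672 \<le> r\<close> by (rule card_three_triangles_le)
  also have "\<dots> \<le> 2 * n"
    using r(1) double_triangle[of r] by simp
  finally show False by simp
qed

section \<open>Small numbers\<close>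

text \<open>
  A finite set of numbers is encoded by the bits of an integer. The result is the sumset of \<open>m\<close> and
  \<open>{T y - T x | y. x < y \<le> x + j}\<close>, computed by Horner's scheme.
\<close>

fun triangle_shifts :: "nat \<Rightarrow> nat \<Rightarrow> int \<Rightarrow> int" where
  "triangle_shifts x 0 m = 0"
| "triangle_shifts x (Suc j) m = push_bit (Suc x) (or m (triangle_shifts (Suc x) j m))"

lemma bit_triangle_shiftsE:
  assumes "bit (triangle_shifts x j m) n"
  obtains y i where "y > x" "bit m i" "triangle y + i = triangle x + n"
proof -
  have "\<exists>y>x. \<exists>i. bit m i \<and> triangle y + i = triangle x + n"
    using assms
  proof (induction j arbitrary: x n)
    case (Suc j)
    define l where "l = n - Suc x"
    have n: "n = l + Suc x" and "bit m l \<or> bit (triangle_shifts (Suc x) j m) l"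
      using Suc.prems by (auto simp: l_def bit_push_bit_iff bit_or_iff simp del: push_bit_Suc)
    then consider "bit m l" | y i where "y > Suc x" "bit m i" "triangle y + i = triangle (Suc x) + l"
      using Suc.IH by blast
    then show ?case
    proof cases
      case 1
      then show ?thesis
        by (intro exI[of _ "Suc x"] conjI exI[of _ l]) (simp_all add: n)
    next
      case 2
      then show ?thesis
        by (intro exI[of _ y] conjI exI[of _ i]) (simp_all add: n)
    qed
  qed simp
  then show ?thesis using that by blast
qed

lemma positive_triangular_sum_if_bit:
  "bit (foldr (triangle_shifts 0) js 1) n \<Longrightarrow> positive_triangular_sum (length js) n"
proof (induction js arbitrary: n)
  case Nil
  then show ?case by (simp add: bit_1_iff positive_triangular_sum_0)
next
  case (Cons j js)
  then obtain y i where "y > 0" "bit (foldr (triangle_shifts 0) js 1) i" "triangle y + i = n"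
    by (auto elim: bit_triangle_shiftsE)
  then show ?case
    using positive_triangular_sum_Suc[of "length js" i y] Cons.IH by auto
qed

lemma three_positive_triangles:
  assumes "30 \<le> n" "n \<le> 702"
  shows "positive_triangular_sum 3 n"
proof -
  let ?S = "foldr (triangle_shifts 0) [36, 36, 8] 1"
  have "take_bit 673 (drop_bit 30 ?S) = mask 673"
    by code_simp
  then have "bit (take_bit 673 (drop_bit 30 ?S)) (n - 30)"
    using assms by (simp only: bit_mask_iff) simp
  then have "bit ?S n"
    using assms by (simp only: bit_take_bit_iff bit_drop_bit_eq) simp
  then have "positive_triangular_sum (length [36, 36, 8 :: nat]) n"
    by (rule positive_triangular_sum_if_bit)
  then show ?thesis by (simp add: numeral_eq_Suc)
qed

lemma four_positive_triangles_small:
  assumes "n \<in> {4, 6} \<union> {8..30}"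
  shows "positive_triangular_sum 4 n"
proof -
  have "\<forall>n\<in>set ([4, 6] @ [8..<31]). bit (foldr (triangle_shifts 0) [6, 6, 6, 6] 1) n"
    by code_simp
  moreover have "n \<in> set ([4, 6] @ [8..<31])"
    using assms unfolding set_append set_upt by auto
  ultimately have "bit (foldr (triangle_shifts 0) [6, 6, 6, 6] 1) n" by blast
  then have "positive_triangular_sum (length [6, 6, 6, 6 :: nat]) n"
    by (rule positive_triangular_sum_if_bit)
  then show ?thesis by (simp add: numeral_eq_Suc)
qed

lemma four_positive_triangles:
  assumes "n \<ge> 4" "n \<noteq> 5" "n \<noteq> 7"
  shows "positive_triangular_sum 4 n"
proof -
  consider "n \<le> 30" | "30 < n" "n < triangle 672" | "triangle 672 \<le> n" by linarith
  then show ?thesis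
  proof cases
    case 1
    then show ?thesis
      using assms by (intro four_positive_triangles_small) auto
  next
    case 2
    obtain w where w: "triangle w \<le> n - 30" "n - 30 < triangle (Suc w)" by (rule triangle_bracket)
    have "w > 0"
      using w 2 by (cases w) auto
    have "triangle w < triangle 672" using w 2 by linarith
    then have "w < 672" by (simp only: triangle_less_iff)
    then have "positive_triangular_sum 3 (n - triangle w)"
      using w 2 by (intro three_positive_triangles) simp_all
    then have "positive_triangular_sum (Suc 3) (triangle w + (n - triangle w))"
      using \<open>w > 0\<close> by (rule positive_triangular_sum_Suc)
    then show ?thesis using w by simp
  qed (rule four_positive_triangles_large)
qed

lemma positive_triangular_sum_iff:
  assumes "k \<ge> 4"
  shows "positive_triangular_sum k n \<longleftrightarrow> k \<le> n \<and> n \<noteq> k + 1 \<and> n \<noteq> k + 3"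
proof
  assume "positive_triangular_sum k n"
  then show "k \<le> n \<and> n \<noteq> k + 1 \<and> n \<noteq> k + 3"
    by (rule positive_triangular_sum_excludes) auto
next
  assume n: "k \<le> n \<and> n \<noteq> k + 1 \<and> n \<noteq> k + 3"
  then have "positive_triangular_sum (k - 4 + 4) (k - 4 + (n - (k - 4)))"
    using assms by (intro positive_triangular_sum_add_ones four_positive_triangles) auto
  then show "positive_triangular_sum k n"
    using assms n by simp
qed

lemma triangular_nonzero_iff: "triangular t \<and> t \<noteq> 0 \<longleftrightarrow> (\<exists>x>0. t = int (triangle x))"
proof
  assume "triangular t \<and> t \<noteq> 0"
  then obtain y where y: "t = y * (y + 1) div 2" "t \<noteq> 0"
    by (auto simp: triangular_def)
  define x where "x = nat (if y \<ge> 0 then y else - y - 1)"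
  have "y * (y + 1) = int (x * Suc x)"
    by (simp add: x_def algebra_simps)
  then have "t = int (triangle x)"
    unfolding y(1) triangle_def by (simp add: zdiv_int)
  then show "\<exists>x>0. t = int (triangle x)"
    using y(2) by (metis gr0I of_nat_0 triangle_0)
next
  assume "\<exists>x>0. t = int (triangle x)"
  then obtain x where x: "x > 0" "t = int (triangle x)" by blast
  then have "t = int x * (int x + 1) div 2"
    by (simp add: triangle_def zdiv_int algebra_simps)
  then show "triangular t \<and> t \<noteq> 0"
    using x by (auto simp: triangular_def triangle_eq_0_iff)
qed

lemma sum_of_nonzero_triangulars_int_iff:
  "sum_of_nonzero_triangulars k (int m) \<longleftrightarrow> positive_triangular_sum k m"
proof
  assume "sum_of_nonzero_triangulars k (int m)"
  then obtain t where "\<forall>i<k. \<exists>x>0. t i = int (triangle x)" and m: "int m = (\<Sum>i<k. t i)"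
    by (auto simp: sum_of_nonzero_triangulars_def triangular_nonzero_iff)
  then obtain x where x: "\<And>i. i < k \<Longrightarrow> x i > 0 \<and> t i = int (triangle (x i))"
    by metis
  then have "int m = int (sum_list (map triangle (map x [0..<k])))"
    by (simp add: m sum_list_sum_nth atLeast0LessThan)
  then have "map x [0..<k] \<in> reps triangle k m"
    by (simp only: reps_def of_nat_eq_iff) simp
  moreover have "0 \<notin> set (map x [0..<k])"
    using x by fastforce
  ultimately show "positive_triangular_sum k m"
    unfolding positive_triangular_sum_def by blast
next
  assume "positive_triangular_sum k m"
  then obtain xs where xs: "length xs = k" "sum_list (map triangle xs) = m" "0 \<notin> set xs"
    by (auto simp: positive_triangular_sum_def reps_def)
  then have "int m = (\<Sum>i<k. int (triangle (xs ! i)))"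
    by (auto simp: sum_list_sum_nth atLeast0LessThan)
  moreover have "\<forall>i<k. xs ! i > 0"
    using xs by (metis gr0I nth_mem)
  ultimately show "sum_of_nonzero_triangulars k (int m)"
    unfolding sum_of_nonzero_triangulars_def triangular_nonzero_iff
    by (intro exI[of _ "\<lambda>i. int (triangle (xs ! i))"]) auto
qed

theorem theorem3p12:
  fixes k :: nat and n :: int
  assumes "k \<ge> 4" and "n > 0"
  shows "sum_of_nonzero_triangulars k n \<longleftrightarrow>
           n \<notin> {1..int k - 1} \<union> {int k + 1, int k + 3}"
proof -
  obtain m where n: "n = int m"
    using assms(2) by (metis less_imp_le nonneg_int_cases)
  have "sum_of_nonzero_triangulars k n \<longleftrightarrow> k \<le> m \<and> m \<noteq> k + 1 \<and> m \<noteq> k + 3"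
    unfolding n sum_of_nonzero_triangulars_int_iff
    by (rule positive_triangular_sum_iff[OF assms(1)])
  also have "\<dots> \<longleftrightarrow> n \<notin> {1..int k - 1} \<union> {int k + 1, int k + 3}"
    using assms(2) unfolding n by auto
  finally show ?thesis .
qed

end
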